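(* Let $n=2k$ with $k\geq 2$ an integer, and let $\overline{\Gamma}=\overline{C_n(1,\frac{n}{2})}$ be the complement of the circulant graph $C_n(1,\frac n2)$. Then: (i) $W(\overline{\Gamma})=\frac{n(n+2)}{2}$; (ii) $S(\overline{\Gamma})=n(n-4)(n+2)$; (iii) $G(\overline{\Gamma})=\frac{n(n+2)(n-4)^2}{2}$; (iv) $WW(\overline{\Gamma})=\frac{n(n+5)}{2}$; (v) $H(\overline{\Gamma})=\frac{n(2n-5)}{4}$; (vi) $H_A(\overline{\Gamma})=\frac{n(n-4)(2n-5)}{2}$; (vii) $H_M(\overline{\Gamma})=\frac{n(2n-5)(n-4)^2}{4}$; (viii) $T_{AG}(\overline{\Gamma})=\frac{n(n-4)}{2}$; (ix) $T_{GA}(\overline{\Gamma})=\frac{n(n-4)}{2}$; (x) $T_{SC}(\overline{\Gamma})=\frac{n(n-4)}{2\sqrt{2}\sqrt{n+2}}$; (xi) $T_{ABC}(\overline{\Gamma})=\frac{n(n-4)\sqrt{n+1}}{\sqrt{2}(n+2)}$; (xii) $T_{AZ}(\overline{\Gamma})=\frac{n(n-4)(n+2)^6}{16(n+1)^3}$; (xiii) $RT_{AG}(\overline{\Gamma})=\frac{n(n-4)}{2}$; (xiv) $RT_{GA}(\overline{\Gamma})=\frac{n(n-4)}{2}$; (xv) $RT_{SC}(\overline{\Gamma})=\frac{n(n-4)}{2\sqrt{2n-5}}$; (xvi) $RT_{ABC}(\overline{\Gamma})=\frac{n(n-4)\sqrt{2n-7}}{2n-5}$; (xvii) $RT_{A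Z}(\overline{\Gamma})=\frac{n(n-4)(2n-5)^6}{128(2n-7)^3}$.
   Context: For $S\subseteq\mathbb{Z}_n\setminus\{0\}$, the circulant graph $C_n(S)$ is the simple undirected graph with vertex set $\mathbb{Z}_n$ and edge set $\{\{g,s+g\}: g\in\mathbb{Z}_n, s\in S\}$ (addition mod $n$); $C_n(1,a)$ means $C_n(\{1,a\})$. $\overline{\Gamma}$ denotes the complement of $\Gamma$. For a graph $\Gamma$, let $d(u,v)$ be the length of a shortest path between $u$ and $v$, $\deg(v)$ the degree of $v$, $\sigma(v)=\sum_{u\neq v}d(u,v)$ the transmission of $v$, and $rs(v)=\sum_{u\neq v}\frac{1}{d(u,v)}$ the reciprocal transmission of $v$. Below, $\sum_{\{u,v\}}$ is over unordered pairs of distinct vertices and $\sum_{uv\in E}$ is over (undirected) edges of $\Gamma$. The indices are: $W=\sum_{\{u,v\}}d(u,v)$ (Wiener); $WW=\frac12\sum_{\{u,v\}}[d(u,v)+d(u,v)^2]$ (hyper-Wiener); $H=\sum_{\{u,v\}}\frac{1}{d(u,v)}$ (Harary); $S=\sum_{\{u,v\}}[\deg(u)+\deg(v)]d(u,v)$ (Schultz); $G=\sum_{\{u,v\}}\deg(u)\deg(v)d(u,v)$ (Gutman); $H_A=\sum_{\{u,v\}}\frac{\deg(u)+\deg(v)}{d(u,v)}$ and $H_M=\sum_{\{u,v\}}\frac{\deg(u)\deg(v)}{d(u,v)}$ (additively and multiplicatively weighted Harary); $T_{GA}=\sum_{uv\in E}\frac{2\sqrt{\sigma(u)\sigma(v)}}{\sigma(u)+\sigma(v)}$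 (transmission geometric-arithmetic); $T_{AG}=\sum_{uv\in E}\frac{\sigma(u)+\sigma(v)}{2\sqrt{\sigma(u)\sigma(v)}}$ (transmission arithmetic-geometric); $T_{SC}=\sum_{uv\in E}\frac{1}{\sqrt{\sigma(u)+\sigma(v)}}$ (transmission sum-connectivity); $T_{ABC}=\sum_{uv\in E}\sqrt{\frac{\sigma(u)+\sigma(v)-2}{\sigma(u)\sigma(v)}}$ (transmission atom-bond connectivity); $T_{AZ}=\sum_{uv\in E}\left[\frac{\sigma(u)\sigma(v)}{\sigma(u)+\sigma(v)-2}\right]^3$ (transmission augmented Zagreb); and $RT_{GA},RT_{AG},RT_{SC},RT_{ABC},RT_{AZ}$ (the reciprocal transmission versions) are defined by the same formulas as $T_{GA},T_{AG},T_{SC},T_{ABC},T_{AZ}$ respectively, with $\sigma$ replaced by $rs$.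
   Formalization: Proved for k ≥ 4 instead of k ≥ 2: for k = 2 (edgeless graph on 4 vertices) and k = 3 (two disjoint triangles) the complement is disconnected, so distances are undefined and the formulas, e.g. for W and H, fail. *)

theory Defs
  imports Complex_Main
begin

record 'a ugraph =
  verts :: "'a set"
  edges :: "'a set set"

text \<open>The group of integers modulo \<open>n\<close> is represented by the residues \<open>{..<n}\<close>. The connection set
  \<open>S\<close> is meant to consist of nonzero residues, so that every edge has exactly two elements.\<close>

definition circulant :: "nat \<Rightarrow> nat set \<Rightarrow> nat ugraph" where
  "circulant n S = \<lparr> verts = {..<n}, edges = {{g, (s + g) mod n} | g s. g < n \<and> s \<in> S} \<rparr>"

definition all_pairs :: "'a set \<Rightarrow> 'a set set" where
  "all_pairs V = {{u, v} | u v. u \<in> V \<and> v \<in> V \<and> u \<noteq> v}"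

definition graph_complement :: "'a ugraph \<Rightarrow> 'a ugraph" where
  "graph_complement \<Gamma> = \<lparr> verts = verts \<Gamma>, edges = all_pairs (verts \<Gamma>) - edges \<Gamma> \<rparr>"

definition degree :: "'a ugraph \<Rightarrow> 'a \<Rightarrow> nat" where
  "degree \<Gamma> v = card {e \<in> edges \<Gamma>. v \<in> e}"

definition is_path :: "'a ugraph \<Rightarrow> 'a \<Rightarrow> 'a list \<Rightarrow> 'a \<Rightarrow> bool" where
  "is_path \<Gamma> u p v \<longleftrightarrow> p \<noteq> [] \<and> hd p = u \<and> last p = v \<and> set p \<subseteq> verts \<Gamma> \<and> distinct p \<and>
     successively (\<lambda>x y. {x, y} \<in> edges \<Gamma>) p"

text \<open>The length of a path is its number of edges. If no path joins \<open>u\<close> and \<open>v\<close>, the value of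
  \<open>gdist \<Gamma> u v\<close> is unspecified; hence the indices below are meaningful for connected graphs only.\<close>

definition gdist :: "'a ugraph \<Rightarrow> 'a \<Rightarrow> 'a \<Rightarrow> nat" where
  "gdist \<Gamma> u v = (LEAST l. \<exists>p. is_path \<Gamma> u p v \<and> length p = l + 1)"

definition transmission :: "'a ugraph \<Rightarrow> 'a \<Rightarrow> real" where
  "transmission \<Gamma> v = (\<Sum>u\<in>verts \<Gamma> - {v}. real (gdist \<Gamma> u v))"

definition reciprocal_transmission :: "'a ugraph \<Rightarrow> 'a \<Rightarrow> real" where
  "reciprocal_transmission \<Gamma> v = (\<Sum>u\<in>verts \<Gamma> - {v}. 1 / real (gdist \<Gamma> u v))"

text \<open>\<open>upair_sum P f\<close> is the sum of \<open>f u v\<close> over the unordered pairs \<open>{u, v}\<close> in \<open>P\<close>, each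
  pair counted once. The function \<open>f\<close> is meant to be symmetric, so that its value does not depend on
  the order in which the two elements of a pair are taken.\<close>

definition upair_sum :: "'a set set \<Rightarrow> ('a \<Rightarrow> 'a \<Rightarrow> real) \<Rightarrow> real" where
  "upair_sum P f = (\<Sum>e\<in>P. (THE x. \<forall>u v. e = {u, v} \<longrightarrow> x = f u v))"

definition wiener :: "'a ugraph \<Rightarrow> real" where
  "wiener \<Gamma> = upair_sum (all_pairs (verts \<Gamma>)) (\<lambda>u v. real (gdist \<Gamma> u v))"

definition hyper_wiener :: "'a ugraph \<Rightarrow> real" where
  "hyper_wiener \<Gamma> = 1 / 2 *
     upair_sum (all_pairs (verts \<Gamma>)) (\<lambda>u v. real (gdist \<Gamma> u v) + (real (gdist \<Gamma> u v))\<^sup>2)"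

definition harary :: "'a ugraph \<Rightarrow> real" where
  "harary \<Gamma> = upair_sum (all_pairs (verts \<Gamma>)) (\<lambda>u v. 1 / real (gdist \<Gamma> u v))"

definition schultz :: "'a ugraph \<Rightarrow> real" where
  "schultz \<Gamma> = upair_sum (all_pairs (verts \<Gamma>))
     (\<lambda>u v. (real (degree \<Gamma> u) + real (degree \<Gamma> v)) * real (gdist \<Gamma> u v))"

definition gutman :: "'a ugraph \<Rightarrow> real" where
  "gutman \<Gamma> = upair_sum (all_pairs (verts \<Gamma>))
     (\<lambda>u v. real (degree \<Gamma> u) * real (degree \<Gamma> v) * real (gdist \<Gamma> u v))"

definition additive_harary :: "'a ugraph \<Rightarrow> real" where
  "additive_harary \<Gamma> = upair_sum (all_pairs (verts \<Gamma>))
     (\<lambda>u v. (real (degree \<Gamma> u) + real (degree \<Gamma> v)) / real (gdist \<Gamma> u v))"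

definition multiplicative_harary :: "'a ugraph \<Rightarrow> real" where
  "multiplicative_harary \<Gamma> = upair_sum (all_pairs (verts \<Gamma>))
     (\<lambda>u v. (real (degree \<Gamma> u) * real (degree \<Gamma> v)) / real (gdist \<Gamma> u v))"

text \<open>The edge-based indices are parametrised by a vertex weight \<open>w\<close>, which is instantiated to the
  transmission and to the reciprocal transmission.\<close>

definition GA_index :: "'a ugraph \<Rightarrow> ('a \<Rightarrow> real) \<Rightarrow> real" where
  "GA_index \<Gamma> w = upair_sum (edges \<Gamma>) (\<lambda>u v. 2 * sqrt (w u * w v) / (w u + w v))"

definition AG_index :: "'a ugraph \<Rightarrow> ('a \<Rightarrow> real) \<Rightarrow> real" where
  "AG_index \<Gamma> w = upair_sum (edges \<Gamma>) (\<lambda>u v. (w u + w v) / (2 * sqrt (w u * w v)))"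

definition SC_index :: "'a ugraph \<Rightarrow> ('a \<Rightarrow> real) \<Rightarrow> real" where
  "SC_index \<Gamma> w = upair_sum (edges \<Gamma>) (\<lambda>u v. 1 / sqrt (w u + w v))"

definition ABC_index :: "'a ugraph \<Rightarrow> ('a \<Rightarrow> real) \<Rightarrow> real" where
  "ABC_index \<Gamma> w = upair_sum (edges \<Gamma>) (\<lambda>u v. sqrt ((w u + w v - 2) / (w u * w v)))"

definition AZ_index :: "'a ugraph \<Rightarrow> ('a \<Rightarrow> real) \<Rightarrow> real" where
  "AZ_index \<Gamma> w = upair_sum (edges \<Gamma>) (\<lambda>u v. ((w u * w v) / (w u + w v - 2)) ^ 3)"

definition T_GA :: "'a ugraph \<Rightarrow> real" where "T_GA \<Gamma> = GA_index \<Gamma> (transmission \<Gamma>)"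
definition T_AG :: "'a ugraph \<Rightarrow> real" where "T_AG \<Gamma> = AG_index \<Gamma> (transmission \<Gamma>)"
definition T_SC :: "'a ugraph \<Rightarrow> real" where "T_SC \<Gamma> = SC_index \<Gamma> (transmission \<Gamma>)"
definition T_ABC :: "'a ugraph \<Rightarrow> real" where "T_ABC \<Gamma> = ABC_index \<Gamma> (transmission \<Gamma>)"
definition T_AZ :: "'a ugraph \<Rightarrow> real" where "T_AZ \<Gamma> = AZ_index \<Gamma> (transmission \<Gamma>)"

definition RT_GA :: "'a ugraph \<Rightarrow> real" where "RT_GA \<Gamma> = GA_index \<Gamma> (reciprocal_transmission \<Gamma>)"
definition RT_AG :: "'a ugraph \<Rightarrow> real" where "RT_AG \<Gamma> = AG_index \<Gamma> (reciprocal_transmission \<Gamma>)"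
definition RT_SC :: "'a ugraph \<Rightarrow> real" where "RT_SC \<Gamma> = SC_index \<Gamma> (reciprocal_transmission \<Gamma>)"
definition RT_ABC :: "'a ugraph \<Rightarrow> real" where "RT_ABC \<Gamma> = ABC_index \<Gamma> (reciprocal_transmission \<Gamma>)"
definition RT_AZ :: "'a ugraph \<Rightarrow> real" where "RT_AZ \<Gamma> = AZ_index \<Gamma> (reciprocal_transmission \<Gamma>)"

text \<open>For \<open>k = 2\<close> and \<open>k = 3\<close> the complement of \<open>C\<^sub>2\<^sub>k(1, k)\<close> (an edgeless graph on four vertices,
  respectively two disjoint triangles) is disconnected, so that its distance-based indices are not
  defined.\<close>

lemma complement_disconnected:
  assumes k: "k = 2 \<or> k = (3::nat)"
  shows "\<not> is_path (graph_complement (circulant (2 * k) {1, k})) 0 p 1"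
proof
  let ?G = "graph_complement (circulant (2 * k) {1, k})"
  assume p: "is_path ?G 0 p 1"
  have adj: "even x \<longleftrightarrow> even y" if "{x, y} \<in> edges ?G" for x y
  proof (rule ccontr)
    assume neq: "even x \<noteq> even y"
    have xy: "x < 2 * k" "y < 2 * k" and ne: "{x, y} \<notin> edges (circulant (2 * k) {1, k})"
      using that by (auto simp: graph_complement_def all_pairs_def circulant_def doubleton_eq_iff)
    have n: "s \<in> {1, k} \<Longrightarrow> y \<noteq> (s + x) mod (2 * k) \<and> x \<noteq> (s + y) mod (2 * k)" for s
      using ne xy unfolding circulant_def by (auto simp: insert_commute)
    have "y \<noteq> (1 + x) mod (2 * k)" "x \<noteq> (1 + y) mod (2 * k)" "y \<noteq> (k + x) mod (2 * k)"
      using n[of 1] n[of k] by auto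
    moreover have "x \<in> {0,1,2,3,4,5}" "y \<in> {0,1,2,3,4,5}"
      using k xy by auto
    ultimately show False
      using k xy neq by (elim disjE) auto
  qed
  have par: "even (hd q) = even (last q)"
    if "q \<noteq> []" "successively R q" "\<And>x y. R x y \<Longrightarrow> even x = even y"
    for q :: "nat list" and R
    using that
  proof (induction q)
    case (Cons a q)
    note IH = this
    show ?case
    proof (cases q)
      case (Cons b r)
      then have "R a b" "successively R q" "q \<noteq> []"
        using IH(3) by auto
      then show ?thesis
        using IH(1)[OF _ _ IH(4)] IH(4)[of a b] Cons by simp
    qed simp
  qed simp
  have "p \<noteq> []" "hd p = 0" "last p = 1" "successively (\<lambda>x y. {x, y} \<in> edges ?G) p"
    using p unfolding is_path_def by blast+
  with par[of p "\<lambda>x y. {x, y} \<in> edges ?G", OF _ _ adj] show False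
    by simp
qed

end

theory Submission imports Defs begin

text \<open>
  The graph \<open>C\<^sub>n(1, n/2)\<close> is cubic, and everything follows from two facts about any \<open>d\<close>-regular
  graph \<open>G\<close> on \<open>n > 2d\<close> vertices. The complement of \<open>G\<close> is regular of degree \<open>n - 1 - d\<close>, and it
  has diameter at most two: if \<open>u\<close> and \<open>v\<close> are adjacent in \<open>G\<close>, then the neighbourhoods of \<open>u\<close> and
  \<open>v\<close> in \<open>G\<close> cover at most \<open>2d < n\<close> vertices, and any vertex outside them is a common neighbour in
  the complement (it differs from \<open>u\<close> and \<open>v\<close>, which lie in each other's neighbourhoods). So in the
  complement the distance of distinct vertices is 2 on the \<open>nd/2\<close> edges of \<open>G\<close> and 1 on the other
  \<open>n(n - 1 - d)/2\<close> pairs (lemmas \<open>gdist_complement\<close> and \<open>card_complement_edges\<close>).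

  Consequently every vertex has transmission \<open>n - 1 + d\<close> and reciprocal transmission
  \<open>n - 1 - d/2\<close>. Each index is then a sum of a function that takes one constant value on the edges
  of the complement and, for the distance-based indices, another one on the edges of \<open>G\<close>, and for
  \<open>d = 3\<close> this gives the closed forms. The bound \<open>n > 6\<close> is where \<open>k \<ge> 4\<close> enters.
\<close>

section \<open>Sums over unordered pairs\<close>

lemma all_pairs_iff: "{u, v} \<in> all_pairs V \<longleftrightarrow> u \<in> V \<and> v \<in> V \<and> u \<noteq> v"
  by (auto simp: all_pairs_def doubleton_eq_iff)

lemma all_pairsE:
  assumes "e \<in> all_pairs V"
  obtains u v where "e = {u, v}" "u \<in> V" "v \<in> V" "u \<noteq> v"
  using assms by (auto simp: all_pairs_def)

lemma all_pairs_subsetD: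
  assumes "P \<subseteq> all_pairs V" "{u, v} \<in> P"
  shows "u \<in> V" "v \<in> V" "u \<noteq> v"
  using subsetD[OF assms] by (simp_all add: all_pairs_iff)

lemma finite_all_pairs: "finite V \<Longrightarrow> finite (all_pairs V)"
  by (rule finite_subset[of _ "Pow V"]) (auto simp: all_pairs_def)

text \<open>The definite description in \<open>upair_sum\<close> denotes \<open>c\<close> only because both orderings of a pair are
  covered by the second hypothesis; \<open>P\<close> consists of doubletons, so no summand is vacuous.\<close>

lemma upair_sum_const:
  assumes "P \<subseteq> all_pairs V" "\<And>u v. {u, v} \<in> P \<Longrightarrow> f u v = c"
  shows "upair_sum P f = real (card P) * c"
proof -
  have "(THE x. \<forall>u v. e = {u, v} \<longrightarrow> x = f u v) = c" if "e \<in> P" for e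
  proof (rule the_equality)
    show "\<forall>u v. e = {u, v} \<longrightarrow> c = f u v"
      using assms(2) that by auto
    from that assms(1) obtain u v where uv: "e = {u, v}"
      by (blast elim: all_pairsE)
    show "x = c" if "\<forall>u v. e = {u, v} \<longrightarrow> x = f u v" for x
      using that uv \<open>e \<in> P\<close> assms(2) by auto
  qed
  then show ?thesis
    by (simp add: upair_sum_def)
qed

lemma upair_sum_Un:
  assumes "finite P" "finite Q" "P \<inter> Q = {}"
  shows "upair_sum (P \<union> Q) f = upair_sum P f + upair_sum Q f"
  unfolding upair_sum_def using assms by (rule sum.union_disjoint)

section \<open>Degrees and short distances\<close>

definition neighbours :: "'a ugraph \<Rightarrow> 'a \<Rightarrow> 'a set" where
  "neighbours G v = {u. {u, v} \<in> edges G}"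

lemma neighbours_subset:
  assumes "edges G \<subseteq> all_pairs (verts G)"
  shows "neighbours G v \<subseteq> verts G - {v}"
  using all_pairs_subsetD[OF assms] unfolding neighbours_def by blast

lemma degree_eq_card_neighbours:
  assumes "edges G \<subseteq> all_pairs (verts G)"
  shows "degree G v = card (neighbours G v)"
proof -
  have "bij_betw (\<lambda>u. {u, v}) (neighbours G v) {e \<in> edges G. v \<in> e}"
  proof (rule bij_betw_imageI)
    show "inj_on (\<lambda>u. {u, v}) (neighbours G v)"
      by (auto simp: inj_on_def doubleton_eq_iff)
    have "e \<in> (\<lambda>u. {u, v}) ` neighbours G v" if e: "e \<in> edges G" "v \<in> e" for e
    proof -
      from e(1) assms obtain x y where xy: "e = {x, y}"
        by (blast elim: all_pairsE)
      with e have "x = v \<and> y \<in> neighbours G v \<or> y = v \<and> x \<in> neighbours G v"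
        by (auto simp: neighbours_def insert_commute)
      with xy show ?thesis
        by (auto simp: insert_commute)
    qed
    then show "(\<lambda>u. {u, v}) ` neighbours G v = {e \<in> edges G. v \<in> e}"
      by (auto simp: neighbours_def)
  qed
  then show ?thesis
    by (simp add: degree_def bij_betw_same_card)
qed

text \<open>The handshake lemma: counting incidences of vertices and edges in two ways.\<close>

lemma handshake_regular:
  assumes fin: "finite (verts G)" and sub: "edges G \<subseteq> all_pairs (verts G)"
    and reg: "\<And>v. v \<in> verts G \<Longrightarrow> degree G v = d"
  shows "2 * card (edges G) = card (verts G) * d"
proof -
  have finE: "finite (edges G)"
    using sub finite_all_pairs[OF fin] by (rule finite_subset)
  have "(\<Sum>v\<in>verts G. card {e \<in> edges G. v \<in> e}) = (\<Sum>e\<in>edges G. 2)"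
  proof (rule sum_multicount_gen[OF fin finE], rule ballI)
    fix e assume "e \<in> edges G"
    with sub obtain u v where "e = {u, v}" "u \<in> verts G" "v \<in> verts G" "u \<noteq> v"
      by (blast elim: all_pairsE)
    then have "{x \<in> verts G. x \<in> e} = {u, v}" "u \<noteq> v"
      by auto
    then show "card {x \<in> verts G. x \<in> e} = 2"
      by simp
  qed
  with reg show ?thesis
    by (simp add: degree_def)
qed

lemma gdist_adjacent:
  assumes "u \<in> verts G" "v \<in> verts G" "u \<noteq> v" "{u, v} \<in> edges G"
  shows "gdist G u v = 1"
  unfolding gdist_def
proof (rule Least_equality)
  have "is_path G u [u, v] v"
    using assms by (simp add: is_path_def)
  then show "\<exists>p. is_path G u p v \<and> length p = 1 + 1"
    by (intro exI[of _ "[u, v]"]) simp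
next
  fix l assume "\<exists>p. is_path G u p v \<and> length p = l + 1"
  with \<open>u \<noteq> v\<close> show "1 \<le> l"
    by (cases l) (auto simp: is_path_def length_Suc_conv)
qed

lemma gdist_common_neighbour:
  assumes "u \<in> verts G" "v \<in> verts G" "w \<in> verts G" "u \<noteq> v" "w \<noteq> u" "w \<noteq> v"
    and "{u, v} \<notin> edges G" "{u, w} \<in> edges G" "{w, v} \<in> edges G"
  shows "gdist G u v = 2"
  unfolding gdist_def
proof (rule Least_equality)
  have "is_path G u [u, w, v] v"
    using assms by (simp add: is_path_def)
  then show "\<exists>p. is_path G u p v \<and> length p = 2 + 1"
    by (intro exI[of _ "[u, w, v]"]) simp
next
  fix l assume "\<exists>p. is_path G u p v \<and> length p = l + 1"
  then obtain p where p: "is_path G u p v" "length p = l + 1"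
    by blast
  show "2 \<le> l"
  proof (rule ccontr)
    assume "\<not> 2 \<le> l"
    then have "l = 0 \<or> l = 1"
      by auto
    then show False
      using p assms(4,7) by (auto simp: is_path_def length_Suc_conv)
  qed
qed

section \<open>Complements of sparse regular graphs\<close>

locale sparse_regular_graph =
  fixes G :: "'a ugraph" and d :: nat
  assumes finite_verts: "finite (verts G)"
    and edges_subset: "edges G \<subseteq> all_pairs (verts G)"
    and regular: "v \<in> verts G \<Longrightarrow> degree G v = d"
    and sparse: "2 * d < card (verts G)"
begin

abbreviation (input) order :: nat where "order \<equiv> card (verts G)"

abbreviation (input) H :: "'a ugraph" where "H \<equiv> graph_complement G"

lemma verts_complement: "verts H = verts G"
  and edges_complement: "edges H = all_pairs (verts G) - edges G"
  by (simp_all add: graph_complement_def)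

lemma card_neighbours: "v \<in> verts G \<Longrightarrow> card (neighbours G v) = d"
  using regular degree_eq_card_neighbours[OF edges_subset] by simp

lemma finite_neighbours: "finite (neighbours G v)"
  using neighbours_subset[OF edges_subset] finite_verts by (metis finite_Diff finite_subset)

lemma neighbours_complement:
  "v \<in> verts G \<Longrightarrow> neighbours H v = (verts G - {v}) - neighbours G v"
  by (auto simp: neighbours_def edges_complement all_pairs_iff)

lemma card_non_neighbours:
  assumes "v \<in> verts G"
  shows "card ((verts G - {v}) - neighbours G v) = order - 1 - d"
  using assms finite_verts
  by (simp add: card_Diff_subset[OF finite_neighbours neighbours_subset[OF edges_subset]]
      card_neighbours)

lemma degree_complement:
  assumes "v \<in> verts G"
  shows "degree H v = order - 1 - d"
proof -
  have "edges H \<subseteq> all_pairs (verts H)"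
    by (simp add: verts_complement edges_complement)
  then show ?thesis
    using assms by (simp add: degree_eq_card_neighbours neighbours_complement card_non_neighbours)
qed

text \<open>Adjacent vertices of \<open>G\<close> lie in each other's neighbourhoods, so the two neighbourhoods contain
  their own centres and do not exhaust the vertex set.\<close>

lemma complement_common_neighbour:
  assumes "{u, v} \<in> edges G"
  obtains w where "w \<in> verts G" "w \<noteq> u" "w \<noteq> v" "{u, w} \<in> edges H" "{w, v} \<in> edges H"
proof -
  have uv: "u \<in> verts G" "v \<in> verts G"
    using all_pairs_subsetD[OF edges_subset assms] by simp_all
  have "card (neighbours G u \<union> neighbours G v) \<le> 2 * d"
    using card_Un_le[of "neighbours G u" "neighbours G v"] uv by (simp add: card_neighbours)
  then have "\<not> verts G \<subseteq> neighbours G u \<union> neighbours G v"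
    using sparse card_mono[of "neighbours G u \<union> neighbours G v" "verts G"] finite_neighbours
    by fastforce
  then obtain w where w: "w \<in> verts G" "w \<notin> neighbours G u" "w \<notin> neighbours G v"
    by blast
  moreover have "w \<noteq> u" "w \<noteq> v"
    using w assms by (auto simp: neighbours_def insert_commute)
  ultimately show thesis
    using uv by (intro that) (auto simp: edges_complement all_pairs_iff neighbours_def insert_commute)
qed

lemma gdist_complement:
  assumes "u \<in> verts G" "v \<in> verts G" "u \<noteq> v"
  shows "gdist H u v = (if {u, v} \<in> edges G then 2 else 1)"
proof (cases "{u, v} \<in> edges G")
  case True
  then obtain w where "w \<in> verts G" "w \<noteq> u" "w \<noteq> v" "{u, w} \<in> edges H" "{w, v} \<in> edges H"
    by (rule complement_common_neighbour)
  with True show ?thesis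
    using assms gdist_common_neighbour[of u H v w]
    by (simp add: verts_complement edges_complement)
next
  case False
  then show ?thesis
    using assms gdist_adjacent[of u H v]
    by (simp add: verts_complement edges_complement all_pairs_iff)
qed

lemma sum_gdist_complement:
  fixes g :: "nat \<Rightarrow> real"
  assumes "v \<in> verts G"
  shows "(\<Sum>u\<in>verts H - {v}. g (gdist H u v)) = (real order - 1 - real d) * g 1 + real d * g 2"
proof -
  let ?A = "(verts G - {v}) - neighbours G v"
  have "verts H - {v} = ?A \<union> neighbours G v" "?A \<inter> neighbours G v = {}"
    using neighbours_subset[OF edges_subset, of v] by (auto simp: verts_complement)
  then have "(\<Sum>u\<in>verts H - {v}. g (gdist H u v))
      = (\<Sum>u\<in>?A. g (gdist H u v)) + (\<Sum>u\<in>neighbours G v. g (gdist H u v))"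
    using finite_verts finite_neighbours by (simp only: sum.union_disjoint finite_Diff)
  also have "(\<Sum>u\<in>?A. g (gdist H u v)) = (\<Sum>u\<in>?A. g 1)"
    using assms by (intro sum.cong) (auto simp: gdist_complement neighbours_def)
  also have "(\<Sum>u\<in>neighbours G v. g (gdist H u v)) = (\<Sum>u\<in>neighbours G v. g 2)"
    using assms neighbours_subset[OF edges_subset, of v]
    by (intro sum.cong) (auto simp: gdist_complement neighbours_def subset_iff)
  finally show ?thesis
    using assms sparse by (simp add: card_non_neighbours card_neighbours of_nat_diff)
qed

lemma transmission_complement:
  "v \<in> verts G \<Longrightarrow> transmission H v = real order - 1 + real d"
  using sum_gdist_complement[of v real] by (simp add: transmission_def)

lemma reciprocal_transmission_complement:
  "v \<in> verts G \<Longrightarrow> reciprocal_transmission H v = real order - 1 - real d / 2"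
  using sum_gdist_complement[of v "\<lambda>l. 1 / real l"] by (simp add: reciprocal_transmission_def)

lemma card_edges: "real (card (edges G)) = real order * real d / 2"
proof -
  have "2 * card (edges G) = order * d"
    using handshake_regular[OF finite_verts edges_subset regular] by blast
  then have "2 * real (card (edges G)) = real order * real d"
    by (metis of_nat_mult of_nat_numeral)
  then show ?thesis
    by simp
qed

lemma card_complement_edges:
  "real (card (edges H)) = real order * (real order - 1 - real d) / 2"
proof -
  have "2 * card (edges H) = card (verts H) * (order - 1 - d)"
    using finite_verts
    by (intro handshake_regular) (simp_all add: verts_complement edges_complement degree_complement)
  then have "2 * real (card (edges H)) = real order * real (order - 1 - d)"
    by (metis of_nat_mult of_nat_numeral verts_complement)
  moreover have "real (order - 1 - d) = real order - 1 - real d"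
    using sparse by simp
  ultimately have "2 * real (card (edges H)) = real order * (real order - 1 - real d)"
    by metis
  then show ?thesis
    by linarith
qed

lemma pair_sum_complement:
  assumes "\<And>u v. {u, v} \<in> edges H \<Longrightarrow> f u v = a" "\<And>u v. {u, v} \<in> edges G \<Longrightarrow> f u v = b"
  shows "upair_sum (all_pairs (verts H)) f
    = real order * (real order - 1 - real d) / 2 * a + real order * real d / 2 * b"
proof -
  have "all_pairs (verts H) = edges H \<union> edges G"
    using edges_subset by (auto simp: verts_complement edges_complement)
  moreover have "upair_sum (edges H \<union> edges G) f = upair_sum (edges H) f + upair_sum (edges G) f"
    using finite_all_pairs[OF finite_verts] edges_subset
    by (intro upair_sum_Un) (auto simp: edges_complement intro: finite_subset)
  moreover have "upair_sum (edges H) f = real (card (edges H)) * a"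
    using assms(1) by (intro upair_sum_const[where V = "verts G"]) (auto simp: edges_complement)
  moreover have "upair_sum (edges G) f = real (card (edges G)) * b"
    using assms(2) edges_subset by (intro upair_sum_const)
  ultimately show ?thesis
    by (simp add: card_edges card_complement_edges)
qed

text \<open>All the distance-based indices are instances of this formula: each sums a function of the two
  degrees and the distance, and the degrees are constant.\<close>

lemma degree_distance_sum_complement:
  fixes g :: "nat \<Rightarrow> nat \<Rightarrow> nat \<Rightarrow> real"
  defines "r \<equiv> order - 1 - d"
  shows "upair_sum (all_pairs (verts H)) (\<lambda>u v. g (degree H u) (degree H v) (gdist H u v))
    = real order * (real order - 1 - real d) / 2 * g r r 1 + real order * real d / 2 * g r r 2"
proof (rule pair_sum_complement)
  fix u v
  show "g (degree H u) (degree H v) (gdist H u v) = g r r 1" if "{u, v} \<in> edges H"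
    using that
    by (auto simp: r_def edges_complement all_pairs_iff degree_complement gdist_complement)
  show "g (degree H u) (degree H v) (gdist H u v) = g r r 2" if "{u, v} \<in> edges G"
  proof -
    have "u \<in> verts G" "v \<in> verts G" "u \<noteq> v"
      using all_pairs_subsetD[OF edges_subset that] by simp_all
    with that show ?thesis
      by (simp add: r_def degree_complement gdist_complement)
  qed
qed

text \<open>The edge-based indices are all of this form, with \<open>w\<close> one of the two transmissions.\<close>

lemma edge_sum_complement:
  assumes "\<And>v. v \<in> verts G \<Longrightarrow> w v = s"
  shows "upair_sum (edges H) (\<lambda>u v. g (w u) (w v))
    = real order * (real order - 1 - real d) / 2 * g s s"
proof -
  have "upair_sum (edges H) (\<lambda>u v. g (w u) (w v)) = real (card (edges H)) * g s s"
    using assms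
    by (intro upair_sum_const[where V = "verts G"]) (auto simp: edges_complement all_pairs_iff)
  then show ?thesis
    by (simp add: card_complement_edges)
qed

end

section \<open>The circulant graph with jumps 1 and n/2\<close>

lemma verts_circulant [simp]: "verts (circulant n S) = {..<n}"
  by (simp add: circulant_def)

lemma mod_jump_1:
  "g < n \<Longrightarrow> (1 + g) mod n = (if g + 1 = n then 0 else g + 1)" for n :: nat
  by auto

lemma mod_jump_half:
  fixes g k :: nat
  assumes "g < 2 * k"
  shows "(k + g) mod (2 * k) = (if g < k then g + k else g - k)"
proof (cases "g < k")
  case False
  then have "k + g = (g - k) + 2 * k"
    by simp
  then have "(k + g) mod (2 * k) = (g - k) mod (2 * k)"
    by (simp only: mod_add_self2)
  with False assms show ?thesis
    by simp
qed simp

lemma circulant_edges_subset: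
  assumes "k \<ge> 2"
  shows "edges (circulant (2 * k) {1, k}) \<subseteq> all_pairs {..<2 * k}"
proof
  fix e assume "e \<in> edges (circulant (2 * k) {1, k})"
  then obtain g s where e: "e = {g, (s + g) mod (2 * k)}" "g < 2 * k" "s = 1 \<or> s = k"
    by (auto simp: circulant_def)
  have "(s + g) mod (2 * k) \<noteq> g"
    using e(3) mod_jump_1[OF e(2)] mod_jump_half[OF e(2)] assms by (auto split: if_splits)
  moreover have "(s + g) mod (2 * k) < 2 * k"
    using assms by (intro mod_less_divisor) simp
  ultimately show "e \<in> all_pairs {..<2 * k}"
    unfolding e(1) all_pairs_iff using e(2) by auto
qed

text \<open>The jump \<open>k\<close> is its own inverse modulo \<open>2 k\<close>, so it contributes one neighbour, while the jump 1
  contributes two. The conditionals spell out the reduction modulo \<open>2 k\<close>.\<close>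

lemma neighbours_circulant:
  assumes "k \<ge> 2" "v < 2 * k"
  shows "neighbours (circulant (2 * k) {1, k}) v =
    {if v + 1 = 2 * k then 0 else v + 1, if v = 0 then 2 * k - 1 else v - 1,
     if v < k then v + k else v - k}"
    (is "_ = ?N")
proof -
  have step: "(1 + g) mod (2 * k) = (if g + 1 = 2 * k then 0 else g + 1)"
      "(k + g) mod (2 * k) = (if g < k then g + k else g - k)" if "g < 2 * k" for g
    using mod_jump_1[OF that] mod_jump_half[OF that] by simp_all
  have "u \<in> ?N" if "{u, v} \<in> edges (circulant (2 * k) {1, k})" for u
  proof -
    from that obtain g s where gs: "{u, v} = {g, (s + g) mod (2 * k)}" "g < 2 * k" "s = 1 \<or> s = k"
      by (auto simp: circulant_def)
    show ?thesis
      using gs(3)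
    proof
      assume "s = 1"
      with gs(1,2) step[OF gs(2)] assms show ?thesis
        by (auto simp: doubleton_eq_iff split: if_splits)
    next
      assume "s = k"
      with gs(1,2) step[OF gs(2)] assms show ?thesis
        by (auto simp: doubleton_eq_iff split: if_splits)
    qed
  qed
  moreover have "{u, v} \<in> edges (circulant (2 * k) {1, k})" if "u \<in> ?N" for u
  proof -
    have edge: "{g, (s + g) mod (2 * k)} \<in> edges (circulant (2 * k) {1, k})"
      if "g < 2 * k" "s = 1 \<or> s = k" for g s
      using that by (auto simp: circulant_def)
    have "u < 2 * k"
      using that assms by (auto split: if_splits)
    moreover have "u = (1 + v) mod (2 * k) \<or> v = (1 + u) mod (2 * k) \<or> u = (k + v) mod (2 * k)"
      using that step[OF assms(2)] step[OF \<open>u < 2 * k\<close>] assms by (auto split: if_splits)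
    ultimately show ?thesis
      using edge[of v 1] edge[of u 1] edge[of v k] assms(2) by (auto simp: insert_commute)
  qed
  ultimately show ?thesis
    unfolding neighbours_def by blast
qed

lemma circulant_sparse_regular:
  assumes "k \<ge> 4"
  shows "sparse_regular_graph (circulant (2 * k) {1, k}) 3"
proof
  let ?G = "circulant (2 * k) {1, k}"
  show "finite (verts ?G)" and "2 * 3 < card (verts ?G)"
    using assms by simp_all
  show sub: "edges ?G \<subseteq> all_pairs (verts ?G)"
    using assms circulant_edges_subset[of k] by simp
  show "degree ?G v = 3" if "v \<in> verts ?G" for v
  proof -
    have k2: "k \<ge> 2"
      using assms by simp
    have v: "v < 2 * k"
      using that by simp
    have "card {a, b, c} = 3" if "a \<noteq> b" "a \<noteq> c" "b \<noteq> c" for a b c :: nat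
      using that by simp
    then have "card (neighbours ?G v) = 3"
      unfolding neighbours_circulant[OF k2 v]
      by this (use v assms in \<open>auto split: if_splits\<close>)
    then show ?thesis
      using degree_eq_card_neighbours[OF sub] by simp
  qed
qed

section \<open>The indices of the complement\<close>

theorem corollary4p3:
  fixes n k :: nat and \<Gamma> :: "nat ugraph"
  assumes "n = 2 * k" and "k \<ge> 4"
    and "\<Gamma> = graph_complement (circulant n {1, n div 2})"
  shows
   "wiener \<Gamma> = real n * (real n + 2) / 2 \<and>
    schultz \<Gamma> = real n * (real n - 4) * (real n + 2) \<and>
    gutman \<Gamma> = real n * (real n + 2) * (real n - 4)\<^sup>2 / 2 \<and>
    hyper_wiener \<Gamma> = real n * (real n + 5) / 2 \<and>
    harary \<Gamma> = real n * (2 * real n - 5) / 4 \<and>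
    additive_harary \<Gamma> = real n * (real n - 4) * (2 * real n - 5) / 2 \<and>
    multiplicative_harary \<Gamma> = real n * (2 * real n - 5) * (real n - 4)\<^sup>2 / 4 \<and>
    T_AG \<Gamma> = real n * (real n - 4) / 2 \<and>
    T_GA \<Gamma> = real n * (real n - 4) / 2 \<and>
    T_SC \<Gamma> = real n * (real n - 4) / (2 * sqrt 2 * sqrt (real n + 2)) \<and>
    T_ABC \<Gamma> = real n * (real n - 4) * sqrt (real n + 1) / (sqrt 2 * (real n + 2)) \<and>
    T_AZ \<Gamma> = real n * (real n - 4) * (real n + 2) ^ 6 / (16 * (real n + 1) ^ 3) \<and>
    RT_AG \<Gamma> = real n * (real n - 4) / 2 \<and>
    RT_GA \<Gamma> = real n * (real n - 4) / 2 \<and>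
    RT_SC \<Gamma> = real n * (real n - 4) / (2 * sqrt (2 * real n - 5)) \<and>
    RT_ABC \<Gamma> = real n * (real n - 4) * sqrt (2 * real n - 7) / (2 * real n - 5) \<and>
    RT_AZ \<Gamma> = real n * (real n - 4) * (2 * real n - 5) ^ 6 / (128 * (2 * real n - 7) ^ 3)"
proof -
  interpret sparse_regular_graph "circulant n {1, n div 2}" 3
    using circulant_sparse_regular[OF assms(2)] assms(1) by simp
  have ord: "card (verts (circulant n {1, n div 2})) = n"
    by simp
  have n: "n \<ge> 8" "real n \<ge> 8"
    using assms(1,2) by linarith+
  have r: "real (n - 4) = real n - 4"
    using n by simp
  have dist: "upair_sum (all_pairs (verts \<Gamma>)) (\<lambda>u v. g (degree \<Gamma> u) (degree \<Gamma> v) (gdist \<Gamma> u v))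
      = real n * (real n - 4) / 2 * g (n - 4) (n - 4) 1 + real n * 3 / 2 * g (n - 4) (n - 4) 2"
    for g :: "nat \<Rightarrow> nat \<Rightarrow> nat \<Rightarrow> real"
    using degree_distance_sum_complement[of g] unfolding ord assms(3) by simp
  \<comment> \<open>The common transmission and reciprocal transmission of the vertices.\<close>
  define s where "s = real n + 2"
  define t where "t = (2 * real n - 5) / 2"
  have "transmission \<Gamma> v = s" if "v \<in> verts (circulant n {1, n div 2})" for v
    unfolding assms(3) transmission_complement[OF that] ord s_def by simp
  then have T: "upair_sum (edges \<Gamma>) (\<lambda>u v. g (transmission \<Gamma> u) (transmission \<Gamma> v))
      = real n * (real n - 4) / 2 * g s s" for g
    using edge_sum_complement[of "transmission \<Gamma>" s g, unfolded ord, folded assms(3)] by simp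
  have "reciprocal_transmission \<Gamma> v = t" if "v \<in> verts (circulant n {1, n div 2})" for v
    unfolding assms(3) reciprocal_transmission_complement[OF that] ord t_def by simp
  then have RT: "upair_sum (edges \<Gamma>)
        (\<lambda>u v. g (reciprocal_transmission \<Gamma> u) (reciprocal_transmission \<Gamma> v))
      = real n * (real n - 4) / 2 * g t t" for g
    using edge_sum_complement[of "reciprocal_transmission \<Gamma>" t g, unfolded ord, folded assms(3)]
    by simp
  have pos: "s > 0" "t > 0"
    using n by (simp_all add: s_def t_def)
  have "wiener \<Gamma> = real n * (real n + 2) / 2"
    unfolding wiener_def dist[of "\<lambda>_ _ l. real l"] by (simp add: field_simps)
  moreover have "schultz \<Gamma> = real n * (real n - 4) * (real n + 2)"
    unfolding schultz_def dist[of "\<lambda>a b l. (real a + real b) * real l"]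
    by (simp add: r field_simps)
  moreover have "gutman \<Gamma> = real n * (real n + 2) * (real n - 4)\<^sup>2 / 2"
    unfolding gutman_def dist[of "\<lambda>a b l. real a * real b * real l"]
    by (simp add: r field_simps power2_eq_square)
  moreover have "hyper_wiener \<Gamma> = real n * (real n + 5) / 2"
    unfolding hyper_wiener_def dist[of "\<lambda>_ _ l. real l + (real l)\<^sup>2"] by (simp add: field_simps)
  moreover have "harary \<Gamma> = real n * (2 * real n - 5) / 4"
    unfolding harary_def dist[of "\<lambda>_ _ l. 1 / real l"] by (simp add: field_simps)
  moreover have "additive_harary \<Gamma> = real n * (real n - 4) * (2 * real n - 5) / 2"
    unfolding additive_harary_def dist[of "\<lambda>a b l. (real a + real b) / real l"]
    by (simp add: r field_simps)
  moreover have "multiplicative_harary \<Gamma> = real n * (2 * real n - 5) * (real n - 4)\<^sup>2 / 4"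
    unfolding multiplicative_harary_def dist[of "\<lambda>a b l. (real a * real b) / real l"]
    by (simp add: r field_simps power2_eq_square)
  moreover have "T_AG \<Gamma> = real n * (real n - 4) / 2" "T_GA \<Gamma> = real n * (real n - 4) / 2"
    unfolding T_AG_def AG_index_def T[of "\<lambda>a b. (a + b) / (2 * sqrt (a * b))"]
      T_GA_def GA_index_def T[of "\<lambda>a b. 2 * sqrt (a * b) / (a + b)"]
    using pos by simp_all
  moreover have "RT_AG \<Gamma> = real n * (real n - 4) / 2" "RT_GA \<Gamma> = real n * (real n - 4) / 2"
    unfolding RT_AG_def AG_index_def RT[of "\<lambda>a b. (a + b) / (2 * sqrt (a * b))"]
      RT_GA_def GA_index_def RT[of "\<lambda>a b. 2 * sqrt (a * b) / (a + b)"]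
    using pos by simp_all
  moreover have "T_SC \<Gamma> = real n * (real n - 4) / (2 * sqrt 2 * sqrt (real n + 2))"
    unfolding T_SC_def SC_index_def T[of "\<lambda>a b. 1 / sqrt (a + b)"]
    by (simp add: s_def real_sqrt_mult[symmetric])
  moreover have "RT_SC \<Gamma> = real n * (real n - 4) / (2 * sqrt (2 * real n - 5))"
    unfolding RT_SC_def SC_index_def RT[of "\<lambda>a b. 1 / sqrt (a + b)"]
    by (simp add: t_def)
  moreover have "T_ABC \<Gamma> = real n * (real n - 4) * sqrt (real n + 1) / (sqrt 2 * (real n + 2))"
  proof -
    have "s + s - 2 = 2 * (real n + 1)"
      by (simp add: s_def)
    then have "sqrt ((s + s - 2) / (s * s)) = sqrt 2 * sqrt (real n + 1) / s"
      using pos by (simp only: real_sqrt_divide real_sqrt_mult) simp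
    also have "\<dots> = 2 * sqrt (real n + 1) / (sqrt 2 * s)"
      using pos by (simp add: field_simps)
    finally show ?thesis
      unfolding T_ABC_def ABC_index_def T[of "\<lambda>a b. sqrt ((a + b - 2) / (a * b))"]
      by (simp add: s_def)
  qed
  moreover have "RT_ABC \<Gamma> = real n * (real n - 4) * sqrt (2 * real n - 7) / (2 * real n - 5)"
  proof -
    have "t + t - 2 = 2 * real n - 7"
      by (simp add: t_def)
    then have "sqrt ((t + t - 2) / (t * t)) = sqrt (2 * real n - 7) / t"
      using pos by (simp add: real_sqrt_divide real_sqrt_mult)
    then show ?thesis
      unfolding RT_ABC_def ABC_index_def RT[of "\<lambda>a b. sqrt ((a + b - 2) / (a * b))"]
      by (simp add: t_def)
  qed
  moreover have "T_AZ \<Gamma> = real n * (real n - 4) * (real n + 2) ^ 6 / (16 * (real n + 1) ^ 3)"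
  proof -
    have "s + s - 2 = 2 * (real n + 1)"
      by (simp add: s_def)
    then have "(s * s / (s + s - 2)) ^ 3 = s ^ 6 / (8 * (real n + 1) ^ 3)"
      by (simp only: power_divide power_mult_distrib flip: power_add) simp
    then show ?thesis
      unfolding T_AZ_def AZ_index_def T[of "\<lambda>a b. ((a * b) / (a + b - 2)) ^ 3"]
      by (simp add: s_def)
  qed
  moreover have "RT_AZ \<Gamma>
      = real n * (real n - 4) * (2 * real n - 5) ^ 6 / (128 * (2 * real n - 7) ^ 3)"
  proof -
    have "t + t - 2 = 2 * real n - 7"
      by (simp add: t_def)
    then have "(t * t / (t + t - 2)) ^ 3 = t ^ 6 / (2 * real n - 7) ^ 3"
      by (simp only: power_divide power_mult_distrib flip: power_add) simp
    also have "t ^ 6 = (2 * real n - 5) ^ 6 / 64"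
      by (simp add: t_def power_divide)
    finally show ?thesis
      unfolding RT_AZ_def AZ_index_def RT[of "\<lambda>a b. ((a * b) / (a + b - 2)) ^ 3"]
      by simp
  qed
  ultimately show ?thesis
    by (intro conjI)
qed

end
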